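(* Consider the adjacency-list model augmented with $\texttt{JUMP}$ and $\texttt{ADJ}$ (and without $\texttt{IN-SORTED}$). For any $n$ and $m$ with $n\le m\le n^2$ and any $\delta\in(0,1]$, there exists a directed graph $G=(V,E)$ with $\Theta(n)$ nodes and $\Theta(m)$ edges such that for any algorithm solving the single-target problem, the expected running time on $G$ with approximation threshold $\delta$, averaged over all targets $t\in V$, is $\Omega\big(\min\{m,(m/\delta)^{1/2},d/\delta\}\big)$, where $d=m/n$.
   Context: Fix a constant $\alpha\in(0,1)$. For a directed graph $G=(V,E)$, an $\alpha$-discounted random walk from $s$: at each step, with probability $\alpha$ it terminates at the current node, otherwise it moves to a uniformly random out-neighbor of the current node. $\pi(s,t)$ is the probability that such a walk from $s$ terminates at $t$. Adjacency-list model: an algorithm accesses $G$ only through constant-time queries $\texttt{DEG-IN}(u)$, $\texttt{DEG-OUT}(u)$ (in-/out-degree of $u$), $\texttt{IN}(u,i)$, $\texttt{OUT}(u,i)$ ($i$-th in-/out-neighbor of $u$). Additional queries: $\texttt{ADJ}(u,v)$ returns whether $(u,v)\in E$; $\texttt{JUMP}()$ returns a uniformly random node of $V$. Single-target problem: given $G$ (via queries), a target $t\in V$ and $\delta\in(0,1]$, output estimates $\hat\pi(s,t)$ for all $s\in V$ such that for each $s$, $\Pr\{|\hat\pi(s,t)-\pi(s,t)|\ge\varepsilon\max\{\pi(s,t),\delta\}\}\le p_f$, where $\varepsilon,p_f$ are fixed small constants; an algorithm solves the problem if this holds for every input. *)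

theory Defs
  imports "HOL-Probability.Probability" "Graph_Theory.Pair_Digraph"
begin

text \<open>
  Directed graphs without parallel arcs (loops are allowed) on the node names
  \<open>0, \<dots>, |V| - 1\<close>. Every node has an out-neighbor, so that the random walk
  below can always move.
\<close>

definition input_graph :: "nat pair_pre_digraph \<Rightarrow> bool" where
  "input_graph G \<longleftrightarrow>
     pair_fin_digraph G \<and> pverts G \<noteq> {} \<and> pverts G = {..<card (pverts G)} \<and>
     (\<forall>u\<in>pverts G. \<exists>v. (u, v) \<in> parcs G)"

text \<open>
  A graph is presented by an arbitrary ordering of its in- and out-neighbors. Nodes outside
  of the graph have empty lists.
\<close>

definition adjacency_lists ::
    "nat pair_pre_digraph \<Rightarrow> (nat \<Rightarrow> nat list) \<Rightarrow> (nat \<Rightarrow> nat list) \<Rightarrow> bool" where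
  "adjacency_lists G ins outs \<longleftrightarrow>
     (\<forall>u. distinct (ins u) \<and> set (ins u) = {v. (v, u) \<in> parcs G} \<and>
          distinct (outs u) \<and> set (outs u) = {v. (u, v) \<in> parcs G})"

datatype walk_state = Active nat | Stopped nat

primrec walk_step :: "real \<Rightarrow> nat pair_pre_digraph \<Rightarrow> walk_state \<Rightarrow> walk_state pmf" where
  "walk_step \<alpha> G (Active u) =
     bind_pmf (bernoulli_pmf \<alpha>) (\<lambda>stop.
       if stop then return_pmf (Stopped u)
       else map_pmf Active (pmf_of_set {v. (u, v) \<in> parcs G}))"
| "walk_step \<alpha> G (Stopped u) = return_pmf (Stopped u)"

primrec walk_after ::
    "real \<Rightarrow> nat pair_pre_digraph \<Rightarrow> nat \<Rightarrow> nat \<Rightarrow> walk_state pmf" where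
  "walk_after \<alpha> G s 0 = return_pmf (Active s)"
| "walk_after \<alpha> G s (Suc k) = bind_pmf (walk_after \<alpha> G s k) (walk_step \<alpha> G)"

text \<open>
  The events ``stopped at \<open>t\<close> within \<open>k\<close> steps'' increase with \<open>k\<close>; their union is the event
  that the walk terminates at \<open>t\<close>.
\<close>

definition ppr :: "real \<Rightarrow> nat pair_pre_digraph \<Rightarrow> nat \<Rightarrow> nat \<Rightarrow> real" where
  "ppr \<alpha> G s t = (SUP k. pmf (walk_after \<alpha> G s k) (Stopped t))"

datatype query = DegIn nat | DegOut nat | In nat nat | Out nat nat | Adj nat nat | Jump

text \<open>\<open>Node None\<close> answers a query for a neighbor whose index is out of range.\<close>

datatype answer = Count nat | Node "nat option" | Adjacent bool | Drawn nat

text \<open>Indices into the neighbor lists start at \<open>0\<close>.\<close>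

definition nth_neighbor :: "nat list \<Rightarrow> nat \<Rightarrow> answer" where
  "nth_neighbor xs i = Node (if i < length xs then Some (xs ! i) else None)"

primrec respond ::
    "nat pair_pre_digraph \<Rightarrow> (nat \<Rightarrow> nat list) \<Rightarrow> (nat \<Rightarrow> nat list) \<Rightarrow> query \<Rightarrow> answer pmf" where
  "respond G ins outs (DegIn u) = return_pmf (Count (in_degree G u))"
| "respond G ins outs (DegOut u) = return_pmf (Count (out_degree G u))"
| "respond G ins outs (In u i) = return_pmf (nth_neighbor (ins u) i)"
| "respond G ins outs (Out u i) = return_pmf (nth_neighbor (outs u) i)"
| "respond G ins outs (Adj u v) = return_pmf (Adjacent ((u, v) \<in> parcs G))"
| "respond G ins outs Jump = map_pmf (\<lambda>v. Node (Some v)) (pmf_of_set (pverts G))"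

text \<open>
  A strategy decides on its next step from the results of all earlier steps. One step is a
  query or an internal step; an internal step may draw from any discrete distribution (with a
  point distribution it is a deterministic computation step). All randomness of the algorithm
  is drawn in this way. \<open>Output\<close> halts with an estimate for every source.
\<close>

datatype action = Ask query | Internal "nat pmf" | Output "nat \<Rightarrow> real"

type_synonym strategy = "answer list \<Rightarrow> action"

text \<open>The strategy used for given \<open>|V|\<close>, \<open>|E|\<close>, target and approximation threshold.\<close>

type_synonym algorithm = "nat \<Rightarrow> nat \<Rightarrow> nat \<Rightarrow> real \<Rightarrow> strategy"

text \<open>
  \<open>history G ins outs S k\<close> is the distribution of the results, in chronological order, of the
  steps that \<open>S\<close> performs until it halts or has performed \<open>k\<close> steps.
\<close>

primrec history ::
    "nat pair_pre_digraph \<Rightarrow> (nat \<Rightarrow> nat list) \<Rightarrow> (nat \<Rightarrow> nat list) \<Rightarrow> strategy \<Rightarrow> nat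
      \<Rightarrow> answer list pmf" where
  "history G ins outs S 0 = return_pmf []"
| "history G ins outs S (Suc k) =
     bind_pmf (history G ins outs S k) (\<lambda>h.
       case S h of
         Ask q \<Rightarrow> map_pmf (\<lambda>a. h @ [a]) (respond G ins outs q)
       | Internal p \<Rightarrow> map_pmf (\<lambda>x. h @ [Drawn x]) p
       | Output est \<Rightarrow> return_pmf h)"

text \<open>
  Each step takes unit time, so the length of the history after at most \<open>k\<close> steps is the
  running time truncated at \<open>k\<close>.
\<close>

definition expected_time ::
    "nat pair_pre_digraph \<Rightarrow> (nat \<Rightarrow> nat list) \<Rightarrow> (nat \<Rightarrow> nat list) \<Rightarrow> strategy \<Rightarrow> ennreal" where
  "expected_time G ins outs S =
     (SUP k. \<integral>\<^sup>+h. of_nat (length h) \<partial>measure_pmf (history G ins outs S k))"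

text \<open>
  The probability that the final output violates \<open>P\<close>, where a run that never halts counts as a
  violation: the events ``no output satisfying \<open>P\<close> within \<open>k\<close> steps'' decrease with \<open>k\<close>.
\<close>

definition failure_prob ::
    "nat pair_pre_digraph \<Rightarrow> (nat \<Rightarrow> nat list) \<Rightarrow> (nat \<Rightarrow> nat list) \<Rightarrow> strategy
      \<Rightarrow> ((nat \<Rightarrow> real) \<Rightarrow> bool) \<Rightarrow> real" where
  "failure_prob G ins outs S P =
     (INF k. measure_pmf.prob (history G ins outs S k) {h. \<not> (\<exists>est. S h = Output est \<and> P est)})"

definition solves_single_target :: "real \<Rightarrow> real \<Rightarrow> real \<Rightarrow> algorithm \<Rightarrow> bool" where
  "solves_single_target \<alpha> \<epsilon> p\<^sub>f A \<longleftrightarrow>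
     (\<forall>G ins outs t \<delta>.
        input_graph G \<and> adjacency_lists G ins outs \<and> t \<in> pverts G \<and> 0 < \<delta> \<and> \<delta> \<le> 1 \<longrightarrow>
        (\<forall>s\<in>pverts G.
           failure_prob G ins outs (A (card (pverts G)) (card (parcs G)) t \<delta>)
             (\<lambda>est. \<not> \<bar>est s - ppr \<alpha> G s t\<bar> \<ge> \<epsilon> * max (ppr \<alpha> G s t) \<delta>) \<le> p\<^sub>f))"

definition average_expected_time ::
    "nat pair_pre_digraph \<Rightarrow> (nat \<Rightarrow> nat list) \<Rightarrow> (nat \<Rightarrow> nat list) \<Rightarrow> algorithm \<Rightarrow> real
      \<Rightarrow> ennreal" where
  "average_expected_time G ins outs A \<delta> =
     (\<Sum>t\<in>pverts G. expected_time G ins outs (A (card (pverts G)) (card (parcs G)) t \<delta>))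
       / of_nat (card (pverts G))"

end

theory Submission
  imports Defs
begin

text \<open>
  In the hard graph, \<open>n\<close> sources of out-degree about \<open>D\<close> cannot reach any target, while every target
  is entered through a hub by a group of \<open>k\<close> gates, each of which has in-degree about \<open>d = m / n\<close> and
  reaches the target with probability of order \<open>1 / k\<close>. Switching an arc \<open>(x, y)\<close> of a source \<open>x\<close>
  with an arc \<open>(f, g)\<close> into a gate, i.e. replacing them by \<open>(x, g)\<close> and \<open>(f, y)\<close>, preserves all
  degrees, but raises \<open>\<pi>(x, t)\<close> from \<open>0\<close> to order \<open>1 / (D k) \<ge> \<delta>\<close>. An algorithm that is correct on
  both graphs must notice the switch, i.e. ask a query that is answered differently, with constant
  probability, and this for each of the \<open>n D \<cdot> d k\<close> possible switches. A single query notices only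
  \<open>O(n D + d k)\<close> of them, so the expected number of queries is of order \<open>min (n D) (d k)\<close>. Choosing
  \<open>D\<close> and \<open>k\<close> so as to balance the two gives the bound.
\<close>

section \<open>Discounted random walks\<close>

text \<open>Keeps the contribution of a single intermediate outcome; chained over several steps,
  this bounds the probability of one particular walk.\<close>

lemma pmf_bind_ge: "pmf p x * pmf (f x) y \<le> pmf (bind_pmf p f) y"
proof -
  have "ennreal (pmf p x * pmf (f x) y)
      = (\<integral>\<^sup>+z. ennreal (pmf (f x) y) * indicator {x} z \<partial>measure_pmf p)"
    by (simp add: nn_integral_cmult_indicator emeasure_pmf_single ennreal_mult mult.commute)
  also have "\<dots> \<le> (\<integral>\<^sup>+z. ennreal (pmf (f z) y) \<partial>measure_pmf p)"
    by (intro nn_integral_mono) (auto split: split_indicator)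
  also have "\<dots> = ennreal (pmf (bind_pmf p f) y)"
    by (simp add: ennreal_pmf_bind)
  finally show ?thesis by simp
qed

lemma pmf_walk_after_move:
  assumes "0 < \<alpha>" "\<alpha> < 1" "(u, v) \<in> parcs G" "finite {v. (u, v) \<in> parcs G}"
  shows "pmf (walk_after \<alpha> G s i) (Active u) * ((1 - \<alpha>) / card {v. (u, v) \<in> parcs G})
    \<le> pmf (walk_after \<alpha> G s (Suc i)) (Active v)"
proof -
  let ?N = "{v. (u, v) \<in> parcs G}"
  have ne: "?N \<noteq> {}" using assms by auto
  have "(1 - \<alpha>) / card ?N = pmf (bernoulli_pmf \<alpha>) False * pmf (map_pmf Active (pmf_of_set ?N)) (Active v)"
    using assms ne by (subst pmf_map_inj') (auto simp: inj_def)
  also have "\<dots> \<le> pmf (walk_step \<alpha> G (Active u)) (Active v)"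
    using pmf_bind_ge[of "bernoulli_pmf \<alpha>" False
        "\<lambda>stop. if stop then return_pmf (Stopped u) else map_pmf Active (pmf_of_set ?N)"] by simp
  finally have "pmf (walk_after \<alpha> G s i) (Active u) * ((1 - \<alpha>) / card ?N)
      \<le> pmf (walk_after \<alpha> G s i) (Active u) * pmf (walk_step \<alpha> G (Active u)) (Active v)"
    by (intro mult_left_mono) auto
  also have "\<dots> \<le> pmf (walk_after \<alpha> G s (Suc i)) (Active v)"
    unfolding walk_after.simps by (rule pmf_bind_ge)
  finally show ?thesis .
qed

lemma pmf_walk_after_stop:
  assumes "0 < \<alpha>" "\<alpha> < 1"
  shows "pmf (walk_after \<alpha> G s i) (Active u) * \<alpha> \<le> pmf (walk_after \<alpha> G s (Suc i)) (Stopped u)"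
proof -
  have "\<alpha> = pmf (bernoulli_pmf \<alpha>) True * pmf (return_pmf (Stopped u)) (Stopped u)"
    using assms by simp
  also have "\<dots> \<le> pmf (walk_step \<alpha> G (Active u)) (Stopped u)"
    using pmf_bind_ge[of "bernoulli_pmf \<alpha>" True
        "\<lambda>stop. if stop then return_pmf (Stopped u) else map_pmf Active (pmf_of_set {v. (u, v) \<in> parcs G})"
        "Stopped u"]
    by simp
  finally have "pmf (walk_after \<alpha> G s i) (Active u) * \<alpha>
      \<le> pmf (walk_after \<alpha> G s i) (Active u) * pmf (walk_step \<alpha> G (Active u)) (Stopped u)"
    by (intro mult_left_mono) auto
  also have "\<dots> \<le> pmf (walk_after \<alpha> G s (Suc i)) (Stopped u)"
    unfolding walk_after.simps by (rule pmf_bind_ge)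
  finally show ?thesis .
qed

lemma pmf_walk_after_le_ppr: "pmf (walk_after \<alpha> G s i) (Stopped t) \<le> ppr \<alpha> G s t"
  unfolding ppr_def by (rule cSUP_upper) (auto intro!: bdd_aboveI[of _ 1] simp: pmf_le_1)

text \<open>Only the walk that follows the three arcs and then stops is counted. Out-degrees enter
  through upper bounds, since these suffice for a lower bound.\<close>

lemma ppr_path_ge:
  assumes "0 < \<alpha>" "\<alpha> < 1" "finite (parcs G)"
    and arcs: "(s, u) \<in> parcs G" "(u, v) \<in> parcs G" "(v, t) \<in> parcs G"
    and deg: "card {w. (s, w) \<in> parcs G} \<le> a" "card {w. (u, w) \<in> parcs G} \<le> b"
      "card {w. (v, w) \<in> parcs G} \<le> c"
  shows "\<alpha> * (1 - \<alpha>) ^ 3 / (real a * real b * real c) \<le> ppr \<alpha> G s t"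
proof -
  have fin: "finite {w. (z, w) \<in> parcs G}" for z
    by (rule finite_subset[OF _ finite_imageI[OF \<open>finite (parcs G)\<close>, of snd]]) force
  have move: "p * ((1 - \<alpha>) / real e) \<le> pmf (walk_after \<alpha> G s (Suc i)) (Active y)"
    if "p \<le> pmf (walk_after \<alpha> G s i) (Active z)" "(z, y) \<in> parcs G"
      "card {w. (z, w) \<in> parcs G} \<le> e" "0 \<le> p" for p i z y e
  proof -
    have "0 < card {w. (z, w) \<in> parcs G}" using that fin[of z] by (auto simp: card_gt_0_iff)
    then have "p * ((1 - \<alpha>) / real e)
        \<le> pmf (walk_after \<alpha> G s i) (Active z) * ((1 - \<alpha>) / card {w. (z, w) \<in> parcs G})"
      using that assms by (intro mult_mono divide_left_mono) auto
    also have "\<dots> \<le> pmf (walk_after \<alpha> G s (Suc i)) (Active y)"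
      using assms that fin by (intro pmf_walk_after_move)
    finally show ?thesis .
  qed
  have nn: "0 \<le> (1 - \<alpha>) / real e" for e using assms by simp
  \<comment> \<open>The leading \<open>1\<close> is the probability of being at \<open>s\<close>
    after zero steps.\<close>
  have "1 * ((1 - \<alpha>) / real a) * ((1 - \<alpha>) / real b) * ((1 - \<alpha>) / real c)
      \<le> pmf (walk_after \<alpha> G s (Suc (Suc (Suc 0)))) (Active t)"
    using arcs deg nn by (intro move mult_nonneg_nonneg) auto
  then have "1 * ((1 - \<alpha>) / real a) * ((1 - \<alpha>) / real b) * ((1 - \<alpha>) / real c) * \<alpha>
      \<le> pmf (walk_after \<alpha> G s (Suc (Suc (Suc 0)))) (Active t) * \<alpha>"
    using assms by (intro mult_right_mono) auto
  also have "\<dots> \<le> ppr \<alpha> G s t"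
    using pmf_walk_after_stop[of \<alpha> G s "Suc (Suc (Suc 0))" t] assms
      pmf_walk_after_le_ppr[of \<alpha> G s "Suc (Suc (Suc (Suc 0)))" t] by linarith
  finally show ?thesis by (simp add: power3_eq_cube mult_ac)
qed

text \<open>The walk cannot leave \<open>Z\<close>, so it cannot stop at \<open>t\<close>. The
  hypothesis \<open>out\<close> excludes empty neighbor sets, on which \<open>pmf_of_set\<close> is
  unspecified.\<close>

lemma ppr_outside_closed_set:
  assumes "finite (parcs G)" "s \<in> Z" "t \<notin> Z"
    and closed: "\<And>u v. u \<in> Z \<Longrightarrow> (u, v) \<in> parcs G \<Longrightarrow> v \<in> Z"
    and out: "\<And>u. u \<in> Z \<Longrightarrow> \<exists>v. (u, v) \<in> parcs G"
  shows "ppr \<alpha> G s t = 0"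
proof -
  have fin: "finite {w. (z, w) \<in> parcs G}" for z
    by (rule finite_subset[OF _ finite_imageI[OF \<open>finite (parcs G)\<close>, of snd]]) force
  have supp: "set_pmf (walk_after \<alpha> G s i) \<subseteq> Active ` Z \<union> Stopped ` Z" for i
  proof (induction i)
    case 0
    then show ?case using assms by simp
  next
    case (Suc i)
    have "set_pmf (walk_step \<alpha> G \<sigma>) \<subseteq> Active ` Z \<union> Stopped ` Z"
      if "\<sigma> \<in> Active ` Z \<union> Stopped ` Z" for \<sigma>
    proof (cases \<sigma>)
      case (Active u)
      then have "u \<in> Z" using that by auto
      moreover from this out have "{w. (u, w) \<in> parcs G} \<noteq> {}" by auto
      then have "set_pmf (pmf_of_set {w. (u, w) \<in> parcs G}) = {w. (u, w) \<in> parcs G}"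
        using fin[of u] by (rule set_pmf_of_set)
      ultimately show ?thesis using Active closed
        by (auto split: if_splits)
    next
      case (Stopped u)
      then show ?thesis using that by auto
    qed
    then show ?case using Suc unfolding walk_after.simps set_bind_pmf by blast
  qed
  have "pmf (walk_after \<alpha> G s i) (Stopped t) = 0" for i
    using supp[of i] assms by (auto simp: pmf_eq_0_set_pmf)
  then show ?thesis by (simp add: ppr_def)
qed

section \<open>Query algorithms that must tell graphs apart\<close>

text \<open>A history records answers only, so the queries behind it are recovered by evaluating the
  strategy on the proper prefixes.\<close>

definition asks :: "strategy \<Rightarrow> query set \<Rightarrow> answer list \<Rightarrow> bool" where
  "asks S B h \<longleftrightarrow> (\<exists>i<length h. \<exists>q\<in>B. S (take i h) = Ask q)"

lemma asks_snoc:
  "asks S B (h @ [a]) \<longleftrightarrow> asks S B h \<or> (\<exists>q\<in>B. S h = Ask q)"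
  by (auto simp: asks_def less_Suc_eq)

text \<open>As long as no query of \<open>B\<close> has been asked, every next step has the same
  distribution on both graphs.\<close>

lemma pmf_history_eq_if_not_asks:
  assumes B: "\<And>q. q \<notin> B \<Longrightarrow> respond G ins outs q = respond G' ins' outs' q"
    and "\<not> asks S B h"
  shows "pmf (history G ins outs S k) h = pmf (history G' ins' outs' S k) h"
  using \<open>\<not> asks S B h\<close>
proof (induction k arbitrary: h)
  case 0
  then show ?case by simp
next
  case (Suc k)
  define step where "step = (\<lambda>G ins outs g. case S g of
         Ask q \<Rightarrow> map_pmf (\<lambda>a. g @ [a]) (respond G ins outs q)
       | Internal p \<Rightarrow> map_pmf (\<lambda>x. g @ [Drawn x]) p
       | Output est \<Rightarrow> return_pmf g)"
  have hist: "history G ins outs S (Suc k) = bind_pmf (history G ins outs S k) (step G ins outs)" for G ins outs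
    by (simp add: step_def)
  have supp: "g' = g \<or> (\<exists>a. g' = g @ [a])" if "g' \<in> set_pmf (step G ins outs g)" for g g' G ins outs
    using that by (auto simp: step_def split: action.splits)
  have asks_ext: "asks S B h'" if "h' \<in> set_pmf (step G ins outs g)" "asks S B g \<or> (\<exists>q\<in>B. S g = Ask q)"
    for g h' G ins outs
    using that supp[OF that(1)] by (auto simp: asks_snoc step_def split: action.splits)
  \<comment> \<open>Either every continuation of \<open>g\<close> has asked a query of
    \<open>B\<close>, so that \<open>h\<close> gets weight zero from \<open>g\<close> on both sides,
    or the step distributions at \<open>g\<close> coincide and the induction hypothesis
    applies.\<close>
  have pw: "pmf (history G ins outs S k) g * pmf (step G ins outs g) h
      = pmf (history G' ins' outs' S k) g * pmf (step G' ins' outs' g) h" for g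
  proof (cases "asks S B g \<or> (\<exists>q\<in>B. S g = Ask q)")
    case True
    then have "h \<notin> set_pmf (step G ins outs g)" "h \<notin> set_pmf (step G' ins' outs' g)"
      using asks_ext Suc.prems by blast+
    then show ?thesis by (metis pmf_eq_0_set_pmf mult_zero_right)
  next
    case False
    then have "step G ins outs g = step G' ins' outs' g"
      using B by (auto simp: step_def split: action.splits)
    then show ?thesis using Suc.IH False by simp
  qed
  have "ennreal (pmf (history G ins outs S (Suc k)) h) = ennreal (pmf (history G' ins' outs' S (Suc k)) h)"
    unfolding hist ennreal_pmf_bind nn_integral_measure_pmf
    by (intro nn_integral_cong) (simp flip: ennreal_mult add: pw)
  then show ?case by simp
qed

lemma prob_history_eq_if_not_asks:
  assumes "\<And>q. q \<notin> B \<Longrightarrow> respond G ins outs q = respond G' ins' outs' q"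
    and "\<And>h. h \<in> E \<Longrightarrow> \<not> asks S B h"
  shows "measure_pmf.prob (history G ins outs S k) E = measure_pmf.prob (history G' ins' outs' S k) E"
proof -
  have "emeasure (history G ins outs S k) E = emeasure (history G' ins' outs' S k) E"
    unfolding nn_integral_pmf[symmetric]
    using pmf_history_eq_if_not_asks[OF assms(1)] assms(2)
    by (intro nn_integral_cong) auto
  then show ?thesis by (simp add: measure_pmf.emeasure_eq_measure)
qed

text \<open>A halted run is not changed by further steps, so a success is never lost.\<close>

lemma prob_no_success_antimono:
  assumes "i \<le> j"
  shows "measure_pmf.prob (history G ins outs S j) {h. \<not> (\<exists>est. S h = Output est \<and> P est)}
    \<le> measure_pmf.prob (history G ins outs S i) {h. \<not> (\<exists>est. S h = Output est \<and> P est)}"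
    (is "?p j \<le> ?p i")
proof -
  let ?E = "{h. \<not> (\<exists>est. S h = Output est \<and> P est)}"
  have "?p (Suc l) \<le> ?p l" for l
  proof -
    have "emeasure (history G ins outs S (Suc l)) ?E
        \<le> (\<integral>\<^sup>+h. indicator ?E h \<partial>measure_pmf (history G ins outs S l))"
      unfolding history.simps emeasure_bind_pmf
    proof (rule nn_integral_mono, goal_cases)
      case (1 h)
      then show ?case
        by (cases "h \<in> ?E") (auto simp: measure_pmf.emeasure_le_1 measure_pmf.subprob_emeasure_le_1)
    qed
    then show ?thesis by (simp add: measure_pmf.emeasure_eq_measure)
  qed
  then have "antimono ?p" by (rule decseq_SucI)
  then show ?thesis using assms by (rule antimonoD)
qed

lemma eventually_no_success_prob_less:
  assumes "failure_prob G ins outs S P < r"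
  shows "eventually (\<lambda>k. measure_pmf.prob (history G ins outs S k)
      {h. \<not> (\<exists>est. S h = Output est \<and> P est)} < r) sequentially"
proof -
  from assms obtain i where
    "measure_pmf.prob (history G ins outs S i) {h. \<not> (\<exists>est. S h = Output est \<and> P est)} < r"
    unfolding failure_prob_def
    by (subst (asm) cINF_less_iff) (auto intro!: bdd_belowI[of _ 0])
  then show ?thesis
    using prob_no_success_antimono[of i _ G ins outs S P]
    unfolding eventually_sequentially by (meson le_less_trans)
qed

text \<open>A run that avoids \<open>B\<close> and ends with an output satisfying \<open>P\<close>
  is equally likely on both graphs, but on the second one it violates \<open>P'\<close>, so its
  probability is below 1/4. Failure on the first graph also has probability below 1/4, which leaves
  at least 1/2 for runs that ask a query of \<open>B\<close>.\<close>

lemma eventually_asks_prob_ge: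
  assumes B: "\<And>q. q \<notin> B \<Longrightarrow> respond G ins outs q = respond G' ins' outs' q"
    and P: "failure_prob G ins outs S P < 1 / 4"
    and P': "failure_prob G' ins' outs' S P' < 1 / 4"
    and disj: "\<And>est. \<not> (P est \<and> P' est)"
  shows "eventually (\<lambda>k. measure_pmf.prob (history G ins outs S k) {h. asks S B h} \<ge> 1 / 2) sequentially"
  using eventually_no_success_prob_less[OF P] eventually_no_success_prob_less[OF P']
proof eventually_elim
  case (elim k)
  let ?H = "history G ins outs S k" and ?H' = "history G' ins' outs' S k"
  let ?F = "{h. \<not> (\<exists>est. S h = Output est \<and> P est)}"
  let ?F' = "{h. \<not> (\<exists>est. S h = Output est \<and> P' est)}"
  let ?A = "{h. asks S B h}"
  have "measure_pmf.prob ?H (- ?A - ?F) = measure_pmf.prob ?H' (- ?A - ?F)"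
    by (rule prob_history_eq_if_not_asks[OF B]) auto
  also have "\<dots> \<le> measure_pmf.prob ?H' ?F'"
    using disj by (intro measure_pmf.finite_measure_mono) auto
  finally have *: "measure_pmf.prob ?H (- ?A - ?F) < 1 / 4" using elim by simp
  have "1 = measure_pmf.prob ?H ((?A \<union> ?F) \<union> (- ?A - ?F))"
    by (rule sym, subst measure_pmf.prob_eq_1) auto
  also have "\<dots> \<le> measure_pmf.prob ?H (?A \<union> ?F) + measure_pmf.prob ?H (- ?A - ?F)"
    by (intro measure_Un_le) auto
  also have "measure_pmf.prob ?H (?A \<union> ?F) \<le> measure_pmf.prob ?H ?A + measure_pmf.prob ?H ?F"
    by (intro measure_Un_le) auto
  finally show ?case using * elim by simp
qed

text \<open>Double counting: the expected number of indices \<open>a\<close> whose set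
  \<open>B a\<close> is hit is at least \<open>card I / 2\<close>, while each step hits at most
  \<open>K\<close> of them.\<close>

lemma expected_time_ge_if_asks:
  fixes K :: nat
  assumes "finite I"
    and hit: "\<And>a. a \<in> I \<Longrightarrow> eventually (\<lambda>k.
      measure_pmf.prob (history G ins outs S k) {h. asks S (B a) h} \<ge> 1 / 2) sequentially"
    and K: "\<And>q. card {a \<in> I. q \<in> B a} \<le> K"
  shows "ennreal (card I / 2) \<le> of_nat K * expected_time G ins outs S"
proof -
  \<comment> \<open>Finiteness of \<open>I\<close> yields one truncation point that serves all
    indices.\<close>
  have "eventually (\<lambda>k. \<forall>a\<in>I.
      measure_pmf.prob (history G ins outs S k) {h. asks S (B a) h} \<ge> 1 / 2) sequentially"
    using assms by (simp add: eventually_ball_finite)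
  then obtain k where k: "\<And>a. a \<in> I \<Longrightarrow>
      measure_pmf.prob (history G ins outs S k) {h. asks S (B a) h} \<ge> 1 / 2"
    unfolding eventually_sequentially by blast
  let ?H = "measure_pmf (history G ins outs S k)"
  have count: "(\<Sum>a\<in>I. indicator {h. asks S (B a) h} h) \<le> (of_nat K * of_nat (length h) :: ennreal)" for h
  proof -
    have "(\<Sum>a\<in>I. indicator {h. asks S (B a) h} h) = (of_nat (card {a \<in> I. asks S (B a) h}) :: ennreal)"
      using \<open>finite I\<close> by (simp add: indicator_def sum.If_cases Int_def)
    also have "card {a \<in> I. asks S (B a) h}
        \<le> card (\<Union>i<length h. {a \<in> I. \<exists>q\<in>B a. S (take i h) = Ask q})"
      using \<open>finite I\<close> by (intro card_mono) (auto simp: asks_def)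
    also have "\<dots> \<le> (\<Sum>i<length h. card {a \<in> I. \<exists>q\<in>B a. S (take i h) = Ask q})"
      by (intro card_UN_le) simp
    also have "\<dots> \<le> (\<Sum>i<length h. K)"
    proof (intro sum_mono)
      fix i
      show "card {a \<in> I. \<exists>q\<in>B a. S (take i h) = Ask q} \<le> K"
        using K by (cases "S (take i h)") auto
    qed
    finally show ?thesis by (simp add: mult.commute flip: of_nat_mult)
  qed
  have "ennreal (card I / 2) = (\<Sum>a\<in>I. ennreal (1 / 2))"
    by (subst sum_ennreal) auto
  also have "\<dots> \<le> (\<Sum>a\<in>I. emeasure ?H {h. asks S (B a) h})"
    unfolding measure_pmf.emeasure_eq_measure by (intro sum_mono ennreal_leI k)
  also have "\<dots> = (\<integral>\<^sup>+h. (\<Sum>a\<in>I. indicator {h. asks S (B a) h} h) \<partial>?H)"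
    by (subst nn_integral_sum) auto
  also have "\<dots> \<le> (\<integral>\<^sup>+h. of_nat K * of_nat (length h) \<partial>?H)"
    using count by (intro nn_integral_mono)
  also have "\<dots> = of_nat K * (\<integral>\<^sup>+h. of_nat (length h) \<partial>?H)"
    by (rule nn_integral_cmult) simp
  also have "\<dots> \<le> of_nat K * expected_time G ins outs S"
    unfolding expected_time_def by (intro mult_left_mono SUP_upper) auto
  finally show ?thesis .
qed

section \<open>Switching two arcs\<close>

lemma adjacency_lists_in_degree:
  assumes "adjacency_lists G ins outs"
  shows "in_degree (with_proj G) u = length (ins u)"
proof -
  have "in_arcs (with_proj G) u = (\<lambda>v. (v, u)) ` set (ins u)"
    using assms by (force simp: adjacency_lists_def)
  then show ?thesis
    using assms distinct_card[of "ins u"]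
    by (simp add: in_degree_def card_image inj_on_def adjacency_lists_def)
qed

lemma adjacency_lists_out_degree:
  assumes "adjacency_lists G ins outs"
  shows "out_degree (with_proj G) u = length (outs u)"
proof -
  have "out_arcs (with_proj G) u = (\<lambda>v. (u, v)) ` set (outs u)"
    using assms by (force simp: adjacency_lists_def)
  then show ?thesis
    using assms distinct_card[of "outs u"]
    by (simp add: out_degree_def card_image inj_on_def adjacency_lists_def)
qed

text \<open>Replacement in place keeps the length of a list, hence the degree, and every entry other
  than \<open>p\<close>.\<close>

definition substitute :: "'a \<Rightarrow> 'a \<Rightarrow> 'a list \<Rightarrow> 'a list" where
  "substitute p q xs = map (\<lambda>v. if v = p then q else v) xs"

lemma length_substitute [simp]: "length (substitute p q xs) = length xs"
  by (simp add: substitute_def)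

lemma set_substitute: "p \<in> set xs \<Longrightarrow> set (substitute p q xs) = insert q (set xs - {p})"
  by (auto simp: substitute_def)

lemma distinct_substitute: "distinct xs \<Longrightarrow> q \<notin> set xs \<Longrightarrow> distinct (substitute p q xs)"
  by (auto simp: substitute_def distinct_map inj_on_def)

lemma nth_neighbor_substitute:
  "nth_neighbor (substitute p q xs) i \<noteq> nth_neighbor xs i \<Longrightarrow> xs ! i = p"
  by (auto simp: nth_neighbor_def substitute_def split: if_splits)

definition switch_arcs ::
    "'a \<Rightarrow> 'a \<Rightarrow> 'a \<Rightarrow> 'a \<Rightarrow> 'a pair_pre_digraph \<Rightarrow> 'a pair_pre_digraph" where
  "switch_arcs a b c e G =
     \<lparr>pverts = pverts G, parcs = insert (a, e) (insert (c, b) (parcs G - {(a, b), (c, e)}))\<rparr>"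

text \<open>The pair is junk (\<open>(0, 0)\<close>) for queries whose answer does not depend on a single arc.\<close>

fun probed_arc :: "(nat \<Rightarrow> nat list) \<Rightarrow> (nat \<Rightarrow> nat list) \<Rightarrow> query \<Rightarrow> nat \<times> nat" where
  "probed_arc ins outs (In u i) = (ins u ! i, u)"
| "probed_arc ins outs (Out u i) = (u, outs u ! i)"
| "probed_arc ins outs (Adj u v) = (u, v)"
| "probed_arc ins outs _ = (0, 0)"

locale arc_switch =
  fixes G :: "nat pair_pre_digraph" and a b c e :: nat
  assumes graph: "input_graph G"
    and old: "(a, b) \<in> parcs G" "(c, e) \<in> parcs G"
    and new: "(a, e) \<notin> parcs G" "(c, b) \<notin> parcs G"
begin

abbreviation "G' \<equiv> switch_arcs a b c e G"

lemma distinct_ends: "a \<noteq> c" "b \<noteq> e"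
  using old new by auto

lemma finite_parcs: "finite (parcs G)"
  using graph by (simp add: input_graph_def pair_fin_digraph_def pair_fin_digraph_axioms_def)

lemma pverts_switch [simp]: "pverts G' = pverts G"
  by (simp add: switch_arcs_def)

text \<open>An algorithm is told the numbers of nodes and arcs, so this equality is needed for it to
  run the same strategy on both graphs.\<close>

lemma card_parcs_switch: "card (parcs G') = card (parcs G)"
proof -
  have "card (parcs G - {(a, b), (c, e)}) = card (parcs G) - 2"
    using old distinct_ends finite_parcs by (subst card_Diff_subset) auto
  moreover have "2 \<le> card (parcs G)"
    using card_mono[of "parcs G" "{(a, b), (c, e)}"] old distinct_ends finite_parcs by auto
  ultimately show ?thesis
    using new distinct_ends finite_parcs by (simp add: switch_arcs_def)
qed

text \<open>Lets the out-degree bounds for \<open>ppr_path_ge\<close> be computed in the unswitched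
  graph.\<close>

lemma card_out_neighbors_switch: "card {w. (z, w) \<in> parcs G'} = card {w. (z, w) \<in> parcs G}"
proof -
  have fin: "finite {w. (z, w) \<in> parcs G}"
    by (rule finite_subset[OF _ finite_imageI[OF finite_parcs, of snd]]) force
  have repl: "card (insert q (N - {p})) = card N" if "finite N" "p \<in> N" "q \<notin> N" for p q and N :: "nat set"
    using that card_Suc_Diff1[of N p] by simp
  consider "z = a" | "z = c" | "z \<noteq> a" "z \<noteq> c" by blast
  then show ?thesis
  proof cases
    case 1
    then have "{w. (z, w) \<in> parcs G'} = insert e ({w. (z, w) \<in> parcs G} - {b})"
      using distinct_ends by (auto simp: switch_arcs_def)
    moreover have "b \<in> {w. (z, w) \<in> parcs G}" "e \<notin> {w. (z, w) \<in> parcs G}"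
      using 1 old new by auto
    ultimately show ?thesis using fin repl by metis
  next
    case 2
    then have "{w. (z, w) \<in> parcs G'} = insert b ({w. (z, w) \<in> parcs G} - {e})"
      using distinct_ends by (auto simp: switch_arcs_def)
    moreover have "e \<in> {w. (z, w) \<in> parcs G}" "b \<notin> {w. (z, w) \<in> parcs G}"
      using 2 old new by auto
    ultimately show ?thesis using fin repl by metis
  next
    case 3
    then show ?thesis by (simp add: switch_arcs_def)
  qed
qed

lemma input_graph_switch: "input_graph G'"
proof -
  have wf: "pair_wf_digraph G" and fin: "finite (pverts G)"
    using graph by (auto simp: input_graph_def pair_fin_digraph_def pair_fin_digraph_axioms_def)
  have "pair_wf_digraph G'"
    using old pair_wf_digraph.in_arcsD1[OF wf] pair_wf_digraph.in_arcsD2[OF wf]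
    by unfold_locales (auto simp: switch_arcs_def)
  then have "pair_fin_digraph G'"
    using fin finite_parcs
    by (simp add: pair_fin_digraph_def pair_fin_digraph_axioms_def) (simp add: switch_arcs_def)
  moreover have "\<exists>v. (u, v) \<in> parcs G'" if "u \<in> pverts G" for u
  proof -
    from graph that obtain v where "(u, v) \<in> parcs G" by (auto simp: input_graph_def)
    then show ?thesis
      by (cases "u = a"; cases "u = c") (auto simp: switch_arcs_def)
  qed
  ultimately show ?thesis using graph by (simp add: input_graph_def)
qed

text \<open>Correctness is required for every ordering of the neighbors, so the new graph may be
  presented by lists that differ from the old ones in four entries only.\<close>

definition "switch_ins ins = ins(b := substitute a c (ins b), e := substitute c a (ins e))"
definition "switch_outs outs = outs(a := substitute b e (outs a), c := substitute e b (outs c))"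

lemma adjacency_lists_switch:
  assumes "adjacency_lists G ins outs"
  shows "adjacency_lists G' (switch_ins ins) (switch_outs outs)"
proof -
  have ins: "distinct (ins u)" "set (ins u) = {v. (v, u) \<in> parcs G}"
    and outs: "distinct (outs u)" "set (outs u) = {v. (u, v) \<in> parcs G}" for u
    using assms by (auto simp: adjacency_lists_def)
  have "distinct (switch_ins ins u)" "distinct (switch_outs outs u)" for u
    using ins outs old new by (auto simp: switch_ins_def switch_outs_def intro!: distinct_substitute)
  moreover have "set (switch_ins ins u) = {v. (v, u) \<in> parcs G'}" for u
    using ins(2) old new distinct_ends by (auto simp: switch_ins_def set_substitute switch_arcs_def)
  moreover have "set (switch_outs outs u) = {v. (u, v) \<in> parcs G'}" for u
    using outs(2) old new distinct_ends by (auto simp: switch_outs_def set_substitute switch_arcs_def)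
  ultimately show ?thesis by (simp add: adjacency_lists_def)
qed

text \<open>Degrees and the node set are preserved; a neighbor query changes only at a replaced
  entry, which belongs to a removed arc; \<open>Adj\<close> changes only at the two removed and the
  two added pairs.\<close>

lemma respond_switch:
  assumes adj: "adjacency_lists G ins outs"
    and "probed_arc ins outs q \<notin> {(a, b), (c, e), (a, e), (c, b)}"
  shows "respond G ins outs q = respond G' (switch_ins ins) (switch_outs outs) q"
proof (cases q)
  case (DegIn u)
  then show ?thesis
    by (simp add: adjacency_lists_in_degree[OF adj]
        adjacency_lists_in_degree[OF adjacency_lists_switch[OF adj]])
      (simp add: switch_ins_def)
next
  case (DegOut u)
  then show ?thesis
    by (simp add: adjacency_lists_out_degree[OF adj]
        adjacency_lists_out_degree[OF adjacency_lists_switch[OF adj]])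
      (simp add: switch_outs_def)
next
  case (In u i)
  then have "nth_neighbor (switch_ins ins u) i = nth_neighbor (ins u) i"
    using assms(2) nth_neighbor_substitute[of a c "ins u" i] nth_neighbor_substitute[of c a "ins u" i]
    by (auto simp: switch_ins_def)
  then show ?thesis using In by simp
next
  case (Out u i)
  then have "nth_neighbor (switch_outs outs u) i = nth_neighbor (outs u) i"
    using assms(2) nth_neighbor_substitute[of b e "outs u" i] nth_neighbor_substitute[of e b "outs u" i]
    by (auto simp: switch_outs_def)
  then show ?thesis using Out by simp
next
  case (Adj u v)
  then show ?thesis using assms by (auto simp: switch_arcs_def)
next
  case Jump
  then show ?thesis by simp
qed

end

section \<open>The hard graph\<close>

text \<open>
  The node classes are, in this order: sources \<open>[0, n)\<close>, sinks \<open>[n, 3n)\<close> of the sources,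
  feeders \<open>[3n, 4n)\<close> (only the first \<open>d\<close> of them have arcs), gates \<open>[4n, 5n)\<close>, hubs \<open>[5n, 6n)\<close>
  and targets \<open>[6n, 7n)\<close>. Loops at all nodes ensure that the walk can always move.
\<close>

definition hard_graph :: "nat \<Rightarrow> nat \<Rightarrow> nat \<Rightarrow> nat \<Rightarrow> nat pair_pre_digraph" where
  "hard_graph n d D k = \<lparr>pverts = {..<7 * n}, parcs =
     (\<lambda>v. (v, v)) ` {..<7 * n} \<union>
     (\<lambda>(x, j). (x, n + x + j)) ` ({..<n} \<times> {..<D}) \<union>
     (\<lambda>(f, g). (3 * n + f, 4 * n + g)) ` ({..<d} \<times> {..<n}) \<union>
     (\<lambda>g. (4 * n + g, 5 * n + g div k)) ` {..<n} \<union>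
     (\<lambda>i. (5 * n + i div k, 6 * n + i)) ` {..<n}\<rparr>"

locale hard_graph_params =
  fixes n d D k :: nat
  assumes d: "1 \<le> d" "d \<le> n" and D: "1 \<le> D" "D \<le> d" and k: "1 \<le> k" "k \<le> n"
begin

abbreviation "H \<equiv> hard_graph n d D k"

section \<open>Size and well-formedness of the hard graph\<close>

lemma n: "1 \<le> n"
  using d by simp

lemma finite_parcs_hard: "finite (parcs H)"
  by (simp add: hard_graph_def)

lemma pverts_hard: "pverts H = {..<7 * n}"
  by (simp add: hard_graph_def)

lemma in_parcs_hard_iff: "(u, v) \<in> parcs H \<longleftrightarrow>
    u = v \<and> u < 7 * n \<or> u < n \<and> (\<exists>j<D. v = n + u + j) \<or>
    (\<exists>f<d. \<exists>g<n. u = 3 * n + f \<and> v = 4 * n + g) \<or>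
    (\<exists>g<n. u = 4 * n + g \<and> v = 5 * n + g div k) \<or>
    (\<exists>i<n. u = 5 * n + i div k \<and> v = 6 * n + i)"
  unfolding hard_graph_def by (auto simp: image_iff Bex_def)

lemma div_less: "i < n \<Longrightarrow> i div k < n"
  using div_le_dividend[of i k] by linarith

lemma input_graph_hard: "input_graph H"
proof -
  have "pair_wf_digraph H"
    using D d div_less by unfold_locales (fastforce simp: pverts_hard in_parcs_hard_iff)+
  then have "pair_fin_digraph H"
    using finite_parcs_hard
    by (simp add: pair_fin_digraph_def pair_fin_digraph_axioms_def) (simp add: hard_graph_def)
  moreover have "\<exists>v. (u, v) \<in> parcs H" if "u \<in> pverts H" for u
    using that by (auto simp: pverts_hard in_parcs_hard_iff)
  ultimately show ?thesis
    using n by (auto simp: input_graph_def pverts_hard lessThan_empty_iff)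
qed

lemma card_pverts_hard: "card (pverts H) = 7 * n"
  by (simp add: hard_graph_def)

lemma card_parcs_hard_ge: "d * n \<le> card (parcs H)"
proof -
  have "d * n = card ((\<lambda>(f, g). (3 * n + f, 4 * n + g)) ` ({..<d} \<times> {..<n}))"
    by (subst card_image) (auto simp: inj_on_def)
  also have "\<dots> \<le> card (parcs H)"
    using finite_parcs_hard by (intro card_mono) (auto simp: hard_graph_def)
  finally show ?thesis .
qed

text \<open>The loops contribute 7 to the constant 11, and each of the other four arc families
  contributes 1, by \<open>D \<le> d\<close> and \<open>1 \<le> d\<close>.\<close>

lemma card_parcs_hard_le: "card (parcs H) \<le> 11 * (d * n)"
proof -
  have "card (parcs H) \<le> 7 * n + n * D + d * n + n + n"
    unfolding hard_graph_def pair_pre_digraph.simps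
    by (intro card_Un_le[THEN order_trans] add_mono card_image_le[THEN order_trans]) auto
  moreover have "n * D \<le> d * n" using D by simp
  moreover have "n \<le> d * n" using d by simp
  ultimately show ?thesis by linarith
qed

text \<open>Sources and sinks together form a closed set: the arcs of a source \<open>x\<close> end
  at \<open>n + x + j < 3 * n\<close>, and sinks have only loops.\<close>

lemma ppr_hard_eq_0:
  assumes "x < n" "i < n"
  shows "ppr \<alpha> H x (6 * n + i) = 0"
proof (rule ppr_outside_closed_set[OF finite_parcs_hard, where Z = "{..<3 * n}"])
  show "\<And>u v. u \<in> {..<3 * n} \<Longrightarrow> (u, v) \<in> parcs H \<Longrightarrow> v \<in> {..<3 * n}"
    using D d by (auto simp: in_parcs_hard_iff)
qed (use assms in \<open>auto simp: in_parcs_hard_iff\<close>)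

text \<open>A switch is given by the source arc \<open>(x, j)\<close>, the feeder \<open>f\<close>
  and the position \<open>l\<close> of the gate within its group. The group itself is determined by
  the target.\<close>

definition "switch_params = {..<n} \<times> {..<D} \<times> {..<d} \<times> {..<k}"

text \<open>Restricting to \<open>h < n div k\<close> leaves out an incomplete last group.\<close>

lemma gate_less:
  assumes "h < n div k" "l < k"
  shows "k * h + l < n"
proof -
  have "k * h + l < k * Suc h" using assms by simp
  also have "\<dots> \<le> k * (n div k)" using assms by (intro mult_le_mono2) simp
  also have "\<dots> \<le> n" by simp
  finally show ?thesis .
qed

lemma arc_switch_hard:
  assumes "(x, j, f, l) \<in> switch_params" "h < n div k"
  shows "arc_switch H x (n + x + j) (3 * n + f) (4 * n + (k * h + l))"
proof
  have "x < n" "j < D" "f < d" "l < k" using assms by (auto simp: switch_params_def)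
  moreover from this have "k * h + l < n" using gate_less assms by blast
  ultimately show "(x, n + x + j) \<in> parcs H" "(3 * n + f, 4 * n + (k * h + l)) \<in> parcs H"
    "(x, 4 * n + (k * h + l)) \<notin> parcs H" "(3 * n + f, n + x + j) \<notin> parcs H"
    using D d by (auto simp: in_parcs_hard_iff)
qed (rule input_graph_hard)

text \<open>The path runs from the source through the gate and its hub to the target. With loops,
  the out-degrees are at most \<open>D + 1\<close>, 2 and \<open>k + 1\<close>; bounding them by
  \<open>2 * D\<close>, 2 and \<open>2 * k\<close> gives the factor 8.\<close>

lemma ppr_switch_ge:
  assumes a: "(x, j, f, l) \<in> switch_params" and i: "i < n" "i div k < n div k"
    and "0 < \<alpha>" "\<alpha> < 1"
  shows "\<alpha> * (1 - \<alpha>) ^ 3 / (8 * real D * real k)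
    \<le> ppr \<alpha> (switch_arcs x (n + x + j) (3 * n + f) (4 * n + (k * (i div k) + l)) H) x (6 * n + i)"
proof -
  let ?h = "i div k"
  let ?e = "4 * n + (k * ?h + l)"
  interpret arc_switch H x "n + x + j" "3 * n + f" ?e
    using a i by (intro arc_switch_hard)
  have p: "x < n" "j < D" "f < d" "l < k" using a by (auto simp: switch_params_def)
  have e: "k * ?h + l < n" using gate_less i p by blast
  have div: "(k * ?h + l) div k = ?h" using p by simp
  have "(x, ?e) \<in> parcs G'"
    by (simp add: switch_arcs_def)
  moreover have "(?e, 5 * n + ?h) \<in> parcs G'"
  proof -
    have "(?e, 5 * n + ?h) \<in> parcs H"
      using e div by (auto simp: in_parcs_hard_iff intro!: exI[of _ "k * ?h + l"])
    then show ?thesis using p e d by (auto simp: switch_arcs_def)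
  qed
  moreover have "(5 * n + ?h, 6 * n + i) \<in> parcs G'"
  proof -
    have "(5 * n + ?h, 6 * n + i) \<in> parcs H" using i by (auto simp: in_parcs_hard_iff)
    then show ?thesis using p d by (auto simp: switch_arcs_def)
  qed
  moreover have "card {w. (x, w) \<in> parcs G'} \<le> 2 * D"
  proof -
    have "card {w. (x, w) \<in> parcs H} \<le> card (insert x ((\<lambda>j. n + x + j) ` {..<D}))"
      using p by (intro card_mono) (auto simp: in_parcs_hard_iff)
    also have "\<dots> \<le> Suc D"
      by (intro card_insert_le_m1[THEN order_trans]) (auto intro: card_image_le[THEN order_trans])
    finally show ?thesis using D by (simp add: card_out_neighbors_switch)
  qed
  moreover have "card {w. (?e, w) \<in> parcs G'} \<le> 2"
  proof -
    have "card {w. (?e, w) \<in> parcs H} \<le> card {?e, 5 * n + ?h}"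
      using e div d by (intro card_mono) (auto simp: in_parcs_hard_iff)
    also have "\<dots> \<le> 2" by (simp add: card_insert_if)
    finally show ?thesis by (simp add: card_out_neighbors_switch)
  qed
  moreover have "card {w. (5 * n + ?h, w) \<in> parcs G'} \<le> 2 * k"
  proof -
    have "y \<in> {k * ?h..<k * ?h + k}" if "y div k = ?h" for y
      using that k by (metis atLeastLessThan_iff div_mult_mod_eq le_add1 mod_less_divisor
          mult.commute nat_add_left_cancel_less less_le_trans zero_less_one)
    then have "{w. (5 * n + ?h, w) \<in> parcs H}
        \<subseteq> insert (5 * n + ?h) ((\<lambda>i. 6 * n + i) ` {k * ?h..<k * ?h + k})"
      using d i div_less by (fastforce simp: in_parcs_hard_iff)
    then have "card {w. (5 * n + ?h, w) \<in> parcs H}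
        \<le> card (insert (5 * n + ?h) ((\<lambda>i. 6 * n + i) ` {k * ?h..<k * ?h + k}))"
      by (intro card_mono) auto
    also have "\<dots> \<le> Suc k"
      by (intro card_insert_le_m1[THEN order_trans]) (auto intro: card_image_le[THEN order_trans])
    finally show ?thesis using k by (simp add: card_out_neighbors_switch)
  qed
  moreover have "finite (parcs G')"
    using finite_parcs by (simp add: switch_arcs_def)
  ultimately have "\<alpha> * (1 - \<alpha>) ^ 3 / (real (2 * D) * real 2 * real (2 * k)) \<le> ppr \<alpha> G' x (6 * n + i)"
    using assms by (intro ppr_path_ge)
  then show ?thesis by simp
qed

section \<open>Counting the switches that a query can notice\<close>

lemma card_switch_params: "card switch_params = n * D * (d * k)"
  by (simp add: switch_params_def card_cartesian_product)

text \<open>Fixing one of the four pairs leaves two parameters free: \<open>(f, l)\<close>,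
  \<open>(x, j)\<close>, \<open>(j, f)\<close> or \<open>(j, l)\<close>. In the last case only
  \<open>x + j\<close> is known, as the sinks of different sources overlap, so \<open>j\<close>
  determines \<open>x\<close>.\<close>

lemma card_switches_of_pair:
  "card {(x, j, f, l) \<in> switch_params.
     uv \<in> {(x, n + x + j), (3 * n + f, 4 * n + (k * h + l)), (x, 4 * n + (k * h + l)), (3 * n + f, n + x + j)}}
   \<le> d * k + 3 * (n * D)"
proof -
  obtain u v where uv: "uv = (u, v)" by force
  let ?P = switch_params
  let ?A = "{(x, j, f, l) \<in> ?P. x = u \<and> n + x + j = v}"
  let ?B = "{(x, j, f, l) \<in> ?P. 3 * n + f = u \<and> 4 * n + (k * h + l) = v}"
  let ?C = "{(x, j, f, l) \<in> ?P. x = u \<and> 4 * n + (k * h + l) = v}"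
  let ?D = "{(x, j, f, l) \<in> ?P. 3 * n + f = u \<and> n + x + j = v}"
  have fin: "finite ?P" by (simp add: switch_params_def)
  have "card ?A \<le> card ({..<d} \<times> {..<k})"
    by (rule card_inj_on_le[of "\<lambda>(x, j, f, l). (f, l)"]) (auto simp: inj_on_def switch_params_def)
  then have A: "card ?A \<le> d * k" by simp
  have "card ?B \<le> card ({..<n} \<times> {..<D})"
    by (rule card_inj_on_le[of "\<lambda>(x, j, f, l). (x, j)"]) (auto simp: inj_on_def switch_params_def)
  then have B: "card ?B \<le> n * D" by simp
  have "card ?C \<le> card ({..<D} \<times> {..<d})"
    by (rule card_inj_on_le[of "\<lambda>(x, j, f, l). (j, f)"]) (auto simp: inj_on_def switch_params_def)
  also have "\<dots> \<le> n * D" using d by simp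
  finally have C: "card ?C \<le> n * D" .
  have "card ?D \<le> card ({..<D} \<times> {..<k})"
    by (rule card_inj_on_le[of "\<lambda>(x, j, f, l). (j, l)"]) (auto simp: inj_on_def switch_params_def)
  also have "\<dots> \<le> n * D" using k by simp
  finally have D: "card ?D \<le> n * D" .
  have "card {(x, j, f, l) \<in> ?P.
      uv \<in> {(x, n + x + j), (3 * n + f, 4 * n + (k * h + l)), (x, 4 * n + (k * h + l)), (3 * n + f, n + x + j)}}
    \<le> card (?A \<union> ?B \<union> ?C \<union> ?D)"
    using fin by (intro card_mono) (auto simp: uv intro!: rev_finite_subset[OF fin])
  also have "\<dots> \<le> card ?A + card ?B + card ?C + card ?D"
    by (intro card_Un_le[THEN order_trans] add_mono order_refl)
  finally show ?thesis using A B C D by linarith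
qed

lemma expected_time_hard_ge:
  assumes \<alpha>: "0 < \<alpha>" "\<alpha> < 1" and \<epsilon>: "0 < \<epsilon>" "\<epsilon> \<le> \<alpha> * (1 - \<alpha>) ^ 3 / 16" and "p\<^sub>f \<le> 1 / 8"
    and \<delta>: "0 < \<delta>" "\<delta> \<le> 1" "real D * real k * \<delta> \<le> 1"
    and adj: "adjacency_lists H ins outs" and A: "solves_single_target \<alpha> \<epsilon> p\<^sub>f A"
    and i: "i < n" "i div k < n div k"
  shows "ennreal (real (n * D * (d * k)) / 2) \<le> of_nat (d * k + 3 * (n * D)) *
    expected_time H ins outs (A (card (pverts H)) (card (parcs H)) (6 * n + i) \<delta>)"
proof -
  define S where "S = A (card (pverts H)) (card (parcs H)) (6 * n + i) \<delta>"
  let ?h = "i div k"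
  define B where "B = (\<lambda>(x, j, f, l). {q. probed_arc ins outs q \<in>
    {(x, n + x + j), (3 * n + f, 4 * n + (k * ?h + l)), (x, 4 * n + (k * ?h + l)), (3 * n + f, n + x + j)}})"
  have t: "6 * n + i \<in> pverts H" using i by (simp add: pverts_hard)
  have "eventually (\<lambda>s. measure_pmf.prob (history H ins outs S s) {h. asks S (B a) h} \<ge> 1 / 2) sequentially"
    if a: "a \<in> switch_params" for a
  proof -
    obtain x j f l where a_eq: "a = (x, j, f, l)" by (cases a)
    interpret arc_switch H x "n + x + j" "3 * n + f" "4 * n + (k * ?h + l)"
      using a i unfolding a_eq by (intro arc_switch_hard)
    have x: "x < n" "x \<in> pverts H" using a by (auto simp: a_eq switch_params_def pverts_hard)
    let ?\<pi> = "ppr \<alpha> G' x (6 * n + i)"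
    have "failure_prob H ins outs S
        (\<lambda>est. \<not> \<bar>est x - ppr \<alpha> H x (6 * n + i)\<bar> \<ge> \<epsilon> * max (ppr \<alpha> H x (6 * n + i)) \<delta>) \<le> p\<^sub>f"
      using A input_graph_hard adj t \<delta> x unfolding solves_single_target_def S_def by blast
    then have 1: "failure_prob H ins outs S (\<lambda>est. \<not> \<bar>est x\<bar> \<ge> \<epsilon> * \<delta>) < 1 / 4"
      using ppr_hard_eq_0[OF x(1) i(1)] \<delta> \<open>p\<^sub>f \<le> 1 / 8\<close> by simp
    have "failure_prob G' (switch_ins ins) (switch_outs outs) S
        (\<lambda>est. \<not> \<bar>est x - ?\<pi>\<bar> \<ge> \<epsilon> * max ?\<pi> \<delta>) \<le> p\<^sub>f"
      using A input_graph_switch adjacency_lists_switch[OF adj] t \<delta> x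
      unfolding solves_single_target_def S_def
      by (metis pverts_switch card_parcs_switch)
    then have 2: "failure_prob G' (switch_ins ins) (switch_outs outs) S
        (\<lambda>est. \<not> \<bar>est x - ?\<pi>\<bar> \<ge> \<epsilon> * max ?\<pi> \<delta>) < 1 / 4"
      using \<open>p\<^sub>f \<le> 1 / 8\<close> by simp
    \<comment> \<open>The admissible estimates around 0 and around \<open>?\<pi>\<close> are
      disjoint, because \<open>?\<pi>\<close> is at least the sum of the two tolerances.\<close>
    have disj: "\<not> (\<not> \<bar>est x\<bar> \<ge> \<epsilon> * \<delta> \<and> \<not> \<bar>est x - ?\<pi>\<bar> \<ge> \<epsilon> * max ?\<pi> \<delta>)" for est
    proof -
      have \<kappa>: "\<alpha> * (1 - \<alpha>) ^ 3 \<le> 1"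
        using \<alpha> by (intro mult_le_one power_le_one) auto
      have "2 * \<epsilon> * \<delta> \<le> (\<alpha> * (1 - \<alpha>) ^ 3 / 8) * \<delta>"
        using \<epsilon> \<delta> by (intro mult_right_mono) auto
      also have "\<dots> \<le> (\<alpha> * (1 - \<alpha>) ^ 3 / 8) * (1 / (real D * real k))"
        using \<delta> \<alpha> D k by (intro mult_left_mono) (auto simp: field_simps)
      also have "\<dots> \<le> ?\<pi>"
        using ppr_switch_ge[of x j f l i \<alpha>] a i \<alpha> by (simp add: a_eq)
      finally have ge: "2 * (\<epsilon> * \<delta>) \<le> ?\<pi>" by simp
      have "\<epsilon> * max ?\<pi> \<delta> \<le> ?\<pi> - \<epsilon> * \<delta>"
      proof (cases "?\<pi> \<le> \<delta>")
        case True
        then show ?thesis using ge by (simp add: max_def algebra_simps)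
      next
        \<comment> \<open>Here the second tolerance is \<open>\<epsilon> * ?\<pi>\<close>, at most
          half of \<open>?\<pi>\<close>; the first is at most the other half by
          \<open>ge\<close>.\<close>
        case False
        have "0 \<le> ?\<pi>" using ge \<epsilon> \<delta> by (meson mult_nonneg_nonneg order_trans less_imp_le zero_le_numeral)
        then have "\<epsilon> * ?\<pi> \<le> 1 / 2 * ?\<pi>" using \<epsilon> \<kappa> by (intro mult_right_mono) auto
        then show ?thesis using ge False by simp
      qed
      then show ?thesis by linarith
    qed
    have "respond H ins outs q = respond G' (switch_ins ins) (switch_outs outs) q" if "q \<notin> B a" for q
      using that by (intro respond_switch[OF adj]) (simp add: B_def a_eq)
    then show ?thesis using 1 2 disj by (rule eventually_asks_prob_ge)
  qed
  \<comment> \<open>The count holds for every pair, so the junk values of \<open>probed_arc\<close>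
    do no harm.\<close>
  moreover have "card {a \<in> switch_params. q \<in> B a} \<le> d * k + 3 * (n * D)" for q
  proof -
    have "{a \<in> switch_params. q \<in> B a} = {(x, j, f, l) \<in> switch_params. probed_arc ins outs q \<in>
      {(x, n + x + j), (3 * n + f, 4 * n + (k * ?h + l)), (x, 4 * n + (k * ?h + l)), (3 * n + f, n + x + j)}}"
      unfolding B_def by auto
    then show ?thesis using card_switches_of_pair by simp
  qed
  moreover have "finite switch_params" by (simp add: switch_params_def)
  ultimately show ?thesis
    using expected_time_ge_if_asks[of switch_params H ins outs S B "d * k + 3 * (n * D)"]
    unfolding S_def card_switch_params by blast
qed

end

section \<open>The lower bound\<close>

lemma floor_half_bounds:
  fixes x :: real
  assumes "1 \<le> x"
  shows "1 \<le> nat \<lfloor>x\<rfloor>" "real (nat \<lfloor>x\<rfloor>) \<le> x" "x \<le> 2 * real (nat \<lfloor>x\<rfloor>)"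
proof -
  have 1: "1 \<le> \<lfloor>x\<rfloor>" using assms by simp
  then show "1 \<le> nat \<lfloor>x\<rfloor>" by linarith
  have eq: "real (nat \<lfloor>x\<rfloor>) = real_of_int \<lfloor>x\<rfloor>" using 1 by simp
  then show "real (nat \<lfloor>x\<rfloor>) \<le> x" by simp
  show "x \<le> 2 * real (nat \<lfloor>x\<rfloor>)"
    unfolding eq using 1 real_of_int_floor_add_one_gt[of x] by linarith
qed

text \<open>
  The choice \<open>D \<approx> sqrt (d / (\<delta> n))\<close> balances the number \<open>n D\<close> of arcs leaving the sources against
  the number \<open>d k\<close> of arcs entering the gates of one group, under the constraint \<open>D k \<delta> \<le> 1\<close>.
\<close>

lemma hard_graph_params_exist:
  fixes n m :: nat and \<delta> :: real
  assumes "1 \<le> n" "n \<le> m" "m \<le> n\<^sup>2" "0 < \<delta>" "\<delta> \<le> 1"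
  defines "M \<equiv> Min {real m, (real m / \<delta>) powr (1/2), (real m / real n) / \<delta>}"
  obtains d D k where "hard_graph_params n d D k" "real D * real k * \<delta> \<le> 1"
    "real d * real n \<le> real m" "real m \<le> 2 * (real d * real n)"
    "M \<le> 4 * (real n * real D)" "M \<le> 4 * (real d * real k)"
proof -
  define d where "d = m div n"
  have d1: "1 \<le> d" unfolding d_def using assms div_le_mono[of n m n] by simp
  have dn: "d \<le> n"
    unfolding d_def using assms div_le_mono[of m "n\<^sup>2" n] by (simp add: power2_eq_square)
  have "d * n \<le> m" by (simp add: d_def)
  then have dm: "real d * real n \<le> real m" by (metis of_nat_mult of_nat_le_iff)
  have "m < n + d * n" using assms dividend_less_div_times[of n m] by (simp add: d_def mult.commute)
  also have "\<dots> \<le> 2 * (d * n)" using d1 by simp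
  finally have "real m \<le> real (2 * (d * n))" by (simp only: of_nat_le_iff less_imp_le)
  then have md: "real m \<le> 2 * (real d * real n)" by simp
  \<comment> \<open>Chosen so that \<open>n * s\<close> is the middle term of the minimum;
    \<open>D\<close> is \<open>s\<close> rounded down and clamped to the range from 1 to
    \<open>d\<close>.\<close>
  define s where "s = sqrt (real m / \<delta>) / real n"
  have s0: "0 < s" using assms by (simp add: s_def)
  have ns: "real n * s = sqrt (real m / \<delta>)" using assms by (simp add: s_def)
  have ns2: "(real n * s) * (real n * s) = real m / \<delta>" using assms by (simp add: ns)
  have M: "M \<le> real m" "M \<le> real n * s" "M \<le> (real m / real n) / \<delta>"
    unfolding M_def using assms by (auto simp: ns powr_half_sqrt)
  define D where "D = max 1 (min d (nat \<lfloor>s\<rfloor>))"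
  have D1: "1 \<le> D" and Dd: "D \<le> d" using d1 by (auto simp: D_def)
  have Ds: "D = 1 \<or> real D \<le> s"
  proof (cases "1 \<le> s")
    case True
    then show ?thesis using floor_half_bounds[OF True] by (auto simp: D_def max_def min_def)
  next
    case False
    then have "nat \<lfloor>s\<rfloor> = 0" using s0 by (simp add: floor_eq_iff)
    then show ?thesis by (simp add: D_def)
  qed
  have D\<delta>: "real D * \<delta> \<le> 1"
    using Ds
  proof
    assume "real D \<le> s"
    have "(s * \<delta>) * (s * \<delta>) * (real n * real n) = real m * \<delta>"
      using ns2 assms by (simp add: field_simps)
    also have "\<dots> \<le> (real n * real n) * 1"
      using assms by (intro mult_mono) (auto simp: power2_eq_square simp flip: of_nat_mult)
    finally have "(s * \<delta>) * (s * \<delta>) \<le> 1"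
      using assms by (simp add: mult.commute)
    then have "s * \<delta> \<le> 1"
      using s0 assms by (metis less_1_mult not_le)
    moreover have "real D * \<delta> \<le> s * \<delta>" using \<open>real D \<le> s\<close> assms by simp
    ultimately show ?thesis by linarith
  qed (use assms in simp)
  \<comment> \<open>The largest real value for \<open>k\<close> that the constraint
    \<open>D * k * \<delta> \<le> 1\<close> admits; it is then rounded down and capped at
    \<open>n\<close>.\<close>
  define y where "y = 1 / (real D * \<delta>)"
  have y: "1 \<le> y" using D\<delta> D1 assms by (simp add: y_def)
  define k where "k = min n (nat \<lfloor>y\<rfloor>)"
  have k1: "1 \<le> k" and kn: "k \<le> n" using assms floor_half_bounds(1)[OF y] by (auto simp: k_def)
  have "real k \<le> y" using floor_half_bounds(2)[OF y] by (auto simp: k_def min_def)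
  then have Dk: "real D * real k * \<delta> \<le> 1"
    using D1 assms by (simp add: y_def field_simps)
  have nD: "M \<le> 4 * (real n * real D)"
  proof -
    have nnD: "0 \<le> real n * real D" by simp
    \<comment> \<open>The cases follow the clamping of \<open>D\<close>: the first is settled by the
      term \<open>m\<close> of the minimum, the others by the middle term.\<close>
    consider "D = d" | "s < 1" | "1 \<le> s" "D = nat \<lfloor>s\<rfloor>"
      using floor_half_bounds(1)[of s] d1 unfolding D_def by linarith
    then show ?thesis
    proof cases
      case 1
      then show ?thesis using M md by (simp add: mult.commute)
    next
      case 2
      have "real n * s \<le> real n * real D" using 2 D1 by (intro mult_left_mono) auto
      then show ?thesis using M(2) nnD by linarith
    next
      case 3
      have "real n * s \<le> real n * (2 * real D)"
        using 3 floor_half_bounds(3)[of s] by (intro mult_left_mono) auto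
      then show ?thesis using M(2) nnD by linarith
    qed
  qed
  have dk: "M \<le> 4 * (real d * real k)"
  proof (cases "k = n")
    case True
    then show ?thesis using M md by simp
  next
    case False
    then have "k = nat \<lfloor>y\<rfloor>" by (auto simp: k_def min_def)
    then have "y \<le> 2 * real k" using floor_half_bounds(3)[OF y] by simp
    moreover have "real m / real n \<le> 2 * real d" using md assms by (simp add: field_simps)
    ultimately have "real m / real n * y \<le> 2 * real d * (2 * real k)"
      using y by (intro mult_mono) auto
    \<comment> \<open>For \<open>D = 1\<close> the right-hand side is the last term of the minimum;
      for \<open>D \<le> s\<close> it is at least the middle term \<open>n * s\<close>.\<close>
    moreover have "M \<le> real m / real n * y"
      using Ds
    proof
      assume "D = 1"
      then show ?thesis using M by (simp add: y_def)
    next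
      assume le: "real D \<le> s"
      have "real m / real n * y = (real n * s) * (real n * s) / real n / real D"
        using D1 assms unfolding ns2 by (simp add: y_def field_simps)
      also have "\<dots> = (real n * s) * (s / real D)" using assms by simp
      also have "\<dots> \<ge> (real n * s) * 1"
        using le D1 s0 by (intro mult_left_mono) auto
      finally show ?thesis using M by simp
    qed
    ultimately show ?thesis by simp
  qed
  have "hard_graph_params n d D k"
    using d1 dn D1 Dd k1 kn by unfold_locales
  then show ?thesis using Dk dm md nD dk by (rule that)
qed

theorem theorem5p7:
  fixes \<alpha> :: real
  assumes "0 < \<alpha>" and "\<alpha> < 1"
  shows "\<exists>\<epsilon>\<^sub>0>0. \<exists>p\<^sub>0>0. \<forall>\<epsilon> p\<^sub>f. 0 < \<epsilon> \<and> \<epsilon> \<le> \<epsilon>\<^sub>0 \<and> 0 < p\<^sub>f \<and> p\<^sub>f \<le> p\<^sub>0 \<longrightarrow>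
    (\<exists>c\<^sub>1>0. \<exists>c\<^sub>2>0. \<exists>c>0. \<forall>(n::nat) (m::nat) (\<delta>::real).
       1 \<le> n \<and> n \<le> m \<and> m \<le> n\<^sup>2 \<and> 0 < \<delta> \<and> \<delta> \<le> 1 \<longrightarrow>
       (\<exists>G. input_graph G \<and>
          c\<^sub>1 * real n \<le> real (card (pverts G)) \<and> real (card (pverts G)) \<le> c\<^sub>2 * real n \<and>
          c\<^sub>1 * real m \<le> real (card (parcs G)) \<and> real (card (parcs G)) \<le> c\<^sub>2 * real m \<and>
          (\<forall>ins outs A. adjacency_lists G ins outs \<and> solves_single_target \<alpha> \<epsilon> p\<^sub>f A \<longrightarrow>
             average_expected_time G ins outs A \<delta> \<ge>
               ennreal (c * Min {real m, (real m / \<delta>) powr (1/2), (real m / real n) / \<delta>}))))"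
proof -
  have main: "\<exists>G. input_graph G \<and>
      1 / 2 * real n \<le> real (card (pverts G)) \<and> real (card (pverts G)) \<le> 11 * real n \<and>
      1 / 2 * real m \<le> real (card (parcs G)) \<and> real (card (parcs G)) \<le> 11 * real m \<and>
      (\<forall>ins outs A. adjacency_lists G ins outs \<and> solves_single_target \<alpha> \<epsilon> p\<^sub>f A \<longrightarrow>
         average_expected_time G ins outs A \<delta> \<ge>
           ennreal (1 / 448 * Min {real m, (real m / \<delta>) powr (1/2), (real m / real n) / \<delta>}))"
    if \<epsilon>: "0 < \<epsilon>" "\<epsilon> \<le> \<alpha> * (1 - \<alpha>) ^ 3 / 16" and p: "p\<^sub>f \<le> 1 / 8"
      and nm: "1 \<le> n" "n \<le> m" "m \<le> n\<^sup>2" and \<delta>: "0 < \<delta>" "\<delta> \<le> 1"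
    for \<epsilon> p\<^sub>f \<delta> :: real and n m :: nat
  proof -
    define M where "M = Min {real m, (real m / \<delta>) powr (1/2), (real m / real n) / \<delta>}"
    obtain d D k where params: "hard_graph_params n d D k" and Dk: "real D * real k * \<delta> \<le> 1"
      and dn: "real d * real n \<le> real m" "real m \<le> 2 * (real d * real n)"
      and M: "M \<le> 4 * (real n * real D)" "M \<le> 4 * (real d * real k)"
      using hard_graph_params_exist[OF nm \<delta>] unfolding M_def by metis
    interpret hard_graph_params n d D k by (rule params)
    have "0 \<le> M" unfolding M_def using nm \<delta> by (subst Min_ge_iff) auto
    have avg: "ennreal (1 / 448 * M) \<le> average_expected_time H ins outs A \<delta>"
      if adj: "adjacency_lists H ins outs" and A: "solves_single_target \<alpha> \<epsilon> p\<^sub>f A" for ins outs A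
    proof -
      define T where "T = (\<lambda>t. expected_time H ins outs (A (card (pverts H)) (card (parcs H)) t \<delta>))"
      have T: "ennreal (M / 32) \<le> T (6 * n + i)" if i: "i < k * (n div k)" for i
      proof -
        have "i div k < n div k" using i by (intro less_mult_imp_div_less) (simp add: mult.commute)
        moreover have "i < n" using i times_div_less_eq_dividend[of k n] by linarith
        ultimately have *: "ennreal (real (n * D * (d * k)) / 2)
            \<le> of_nat (d * k + 3 * (n * D)) * T (6 * n + i)"
          unfolding T_def using assms \<epsilon> p \<delta> Dk adj A by (intro expected_time_hard_ge)
        define P where "P = real n * real D"
        define Q where "Q = real d * real k"
        have PQ: "0 < P" "0 < Q" using n d D k by (auto simp: P_def Q_def)
        \<comment> \<open>Since \<open>M / 4\<close> is at most \<open>P\<close> and at most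
          \<open>Q\<close>, it can replace the other factor in each summand.\<close>
        have "M / 4 * (Q + 3 * P) \<le> 4 * (P * Q)"
        proof -
          have "M / 4 * Q \<le> P * Q" using M PQ by (intro mult_right_mono) (auto simp: P_def)
          moreover have "M / 4 * P \<le> Q * P" using M PQ by (intro mult_right_mono) (auto simp: Q_def)
          ultimately show ?thesis by (simp add: algebra_simps)
        qed
        then have "M / 32 \<le> P * Q / 2 / (Q + 3 * P)"
          using PQ by (simp add: field_simps)
        then have "ennreal (M / 32) \<le> ennreal (P * Q / 2 / (Q + 3 * P))"
          by (rule ennreal_leI)
        also have "\<dots> = ennreal (P * Q / 2) / ennreal (Q + 3 * P)"
          using PQ by (intro divide_ennreal[symmetric]) auto
        also have "\<dots> \<le> T (6 * n + i)"
        proof (rule divide_le_posI_ennreal)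
          have "real (d * k + 3 * (n * D)) = Q + 3 * P" "real (n * D * (d * k)) = P * Q"
            by (simp_all add: P_def Q_def)
          then show "ennreal (P * Q / 2) \<le> ennreal (Q + 3 * P) * T (6 * n + i)"
            using * by (simp only: ennreal_of_nat_eq_real_of_nat)
          show "0 < ennreal (Q + 3 * P)" using PQ by (subst ennreal_less_zero_iff) auto
        qed
        finally show ?thesis .
      qed
      \<comment> \<open>The remainder is less than \<open>k\<close>, and there is at least one full
        group, so the full groups cover at least half of the targets.\<close>
      have half: "n \<le> 2 * (k * (n div k))"
      proof -
        have "n < k + k * (n div k)" using k dividend_less_times_div[of k n] by simp
        moreover have "k \<le> k * (n div k)" using k div_le_mono[of k n k] by simp
        ultimately show ?thesis by linarith
      qed
      have "ennreal (1 / 448 * M) = ennreal (real n / 2 * (M / 32) / (7 * real n))"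
        using n by (simp add: field_simps)
      also have "\<dots> \<le> ennreal (real (k * (n div k)) * (M / 32) / (7 * real n))"
      proof -
        have "real n \<le> real (2 * (k * (n div k)))" using half by (simp only: of_nat_le_iff)
        then show ?thesis
          using \<open>0 \<le> M\<close> by (intro ennreal_leI divide_right_mono mult_right_mono) auto
      qed
      also have "\<dots> = (\<Sum>i<k * (n div k). ennreal (M / 32)) / of_nat (7 * n)"
      proof -
        have "(\<Sum>i<k * (n div k). ennreal (M / 32)) = ennreal (real (k * (n div k)) * (M / 32))"
          using \<open>0 \<le> M\<close> by (subst sum_ennreal) auto
        moreover have "of_nat (7 * n) = ennreal (7 * real n)"
          by (simp add: ennreal_of_nat_eq_real_of_nat)
        ultimately show ?thesis
          using n \<open>0 \<le> M\<close> divide_ennreal[of "real (k * (n div k)) * (M / 32)" "7 * real n"] by simp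
      qed
      also have "\<dots> \<le> (\<Sum>t\<in>pverts H. T t) / of_nat (7 * n)"
      proof (rule divide_right_mono_ennreal)
        have "(\<Sum>i<k * (n div k). ennreal (M / 32)) \<le> (\<Sum>i<k * (n div k). T (6 * n + i))"
          using T by (intro sum_mono) auto
        also have "\<dots> = (\<Sum>t\<in>(\<lambda>i. 6 * n + i) ` {..<k * (n div k)}. T t)"
          by (subst sum.reindex) (auto simp: inj_on_def)
        also have "\<dots> \<le> (\<Sum>t\<in>pverts H. T t)"
        proof (rule sum_mono2)
          show "(\<lambda>i. 6 * n + i) ` {..<k * (n div k)} \<subseteq> pverts H"
            by (auto simp: pverts_hard intro: less_le_trans[OF _ times_div_less_eq_dividend])
        qed (auto simp: pverts_hard)
        finally show "(\<Sum>i<k * (n div k). ennreal (M / 32)) \<le> (\<Sum>t\<in>pverts H. T t)" .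
      qed
      finally show ?thesis
        by (simp add: average_expected_time_def T_def card_pverts_hard)
    qed
    have "real (d * n) \<le> real (card (parcs H))" "real (card (parcs H)) \<le> real (11 * (d * n))"
      using card_parcs_hard_ge card_parcs_hard_le by (simp_all only: of_nat_le_iff)
    then have "1 / 2 * real m \<le> real (card (parcs H))" "real (card (parcs H)) \<le> 11 * real m"
      using dn by auto
    then show ?thesis
      using avg input_graph_hard unfolding M_def
      by (intro exI[of _ H]) (simp add: card_pverts_hard)
  qed
  have "0 < \<alpha> * (1 - \<alpha>) ^ 3 / 16" using assms by simp
  then show ?thesis
    using main
    by (intro exI[of _ "\<alpha> * (1 - \<alpha>) ^ 3 / 16"] exI[of _ "1 / 8 :: real"] exI[of _ "1 / 2 :: real"]
        exI[of _ "11 :: real"] exI[of _ "1 / 448 :: real"] conjI allI impI) auto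
qed

end
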